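(* Let $\rho,\kappa>-1$ be real numbers, $n$ an integer with $n+\rho\ge0$, and $z,w\in\mathbb{D}^*$. For every sufficiently small $t$, the function $$G^{\kappa,\rho}_n(z,w|t):=\sum_{m=0}^{+\infty}\frac{t^m\,\mathcal{Z}^{\kappa,\rho}_{m,n}(z,\bar z)\,\mathcal{Z}^{\kappa,\rho}_{m,n}(\bar w,w)}{m!\,(\kappa+1)_m}$$ has the closed expression $$G^{\kappa,\rho}_n(z,w|t)=\frac{(z+tw)^{n+\rho}(\bar w+t\bar z)^{n+\rho}}{(z\bar w)^\rho\,(1+t\bar zw)^{2(n+\rho)+\kappa+1}}\;{}_2F_1\Big(-n-\rho,\,-n-\rho;\ \kappa+1;\ -\frac{t(1-|z|^2)(1-|w|^2)}{(z+tw)(\bar w+t\bar z)}\Big).$$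
   Context: Let $\mathbb{D}=\{z\in\mathbb{C}:|z|<1\}$ and $\mathbb{D}^*=\mathbb{D}\setminus\{0\}$; $\partial/\partial z$ is the Wirtinger derivative and $(a)_n=a(a+1)\cdots(a+n-1)$. For reals $\rho,\kappa>-1$ and integers $m\ge0$, $n$ with $n+\rho\ge0$, the fractional Zernike function on $\mathbb{D}^*$ is $$\mathcal{Z}^{\kappa,\rho}_{m,n}(z,\bar z)=(-1)^m z^{-\rho}(1-|z|^2)^{-\kappa}\frac{\partial^m}{\partial z^m}\Big(z^{n+\rho}(1-|z|^2)^{\kappa+m}\Big),$$ the powers $z^{-\rho}$ and $z^{n+\rho}$ being taken with the same local branch (the result does not depend on the choice). $\mathcal{Z}^{\kappa,\rho}_{m,n}(\bar w,w)$ is the value of the function at the point $\bar w$, and equals $\overline{\mathcal{Z}^{\kappa,\rho}_{m,n}(w,\bar w)}$. ${}_2F_1$ is the Gauss hypergeometric function. For small $t$ (depending on $z,w$), $\frac{(z+tw)^{n+\rho}(\bar w+t\bar z)^{n+\rho}}{(z\bar w)^\rho}$ is understood as $(z\bar w)^n(1+tw/z)^{n+\rho}(1+t\bar z/\bar w)^{n+\rho}$ with principal powers.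
   Formalization: The printed identity has a sign error (for n = ρ = 0 the sum is (1 − t z̄ w)^(−κ−1), not (1 + t z̄ w)^(−κ−1)); the formal theorem proves it with t replaced by −t throughout the closed expression on the right-hand side. *)

theory Defs
  imports "HOL-Analysis.Analysis"
begin

definition wirtinger :: "(complex \<Rightarrow> complex) \<Rightarrow> complex \<Rightarrow> complex" where
  "wirtinger f z =
     (vector_derivative (\<lambda>x. f (z + of_real x)) (at (0::real))
      - \<i> * vector_derivative (\<lambda>y. f (z + \<i> * of_real y)) (at (0::real))) / 2"

(* A branch of the logarithm that is holomorphic near the base point p, also when p lies
   on the negative real axis, where Ln itself is discontinuous. *)

definition local_ln :: "complex \<Rightarrow> complex \<Rightarrow> complex" where
  "local_ln p u = Ln p + Ln (u / p)"

definition local_powr :: "complex \<Rightarrow> real \<Rightarrow> complex \<Rightarrow> complex" where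
  "local_powr p a u = exp (of_real a * local_ln p u)"

(* Both powers use the branch based at the point z of evaluation; the iterated derivative
   at z only depends on the differentiated function near z. *)

definition frac_zernike :: "real \<Rightarrow> real \<Rightarrow> nat \<Rightarrow> int \<Rightarrow> complex \<Rightarrow> complex" where
  "frac_zernike \<kappa> \<rho> m n z =
     (-1) ^ m * local_powr z (- \<rho>) z * of_real ((1 - (cmod z)\<^sup>2) powr (- \<kappa>)) *
     (wirtinger ^^ m)
       (\<lambda>u. local_powr z (of_int n + \<rho>) u * of_real ((1 - (cmod u)\<^sup>2) powr (\<kappa> + of_nat m))) z"

definition zernike_term ::
  "real \<Rightarrow> real \<Rightarrow> int \<Rightarrow> complex \<Rightarrow> complex \<Rightarrow> complex \<Rightarrow> nat \<Rightarrow> complex" where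
  "zernike_term \<kappa> \<rho> n z w t m =
     t ^ m * frac_zernike \<kappa> \<rho> m n z * frac_zernike \<kappa> \<rho> m n (cnj w)
     / (fact m * of_real (pochhammer (\<kappa> + 1) m))"

definition zernike_gen ::
  "real \<Rightarrow> real \<Rightarrow> int \<Rightarrow> complex \<Rightarrow> complex \<Rightarrow> complex \<Rightarrow> complex" where
  "zernike_gen \<kappa> \<rho> n z w t = (\<Sum>m. zernike_term \<kappa> \<rho> n z w t m)"

(* The sum of the Gauss series; it is the Gauss function only where that series converges. *)

definition gauss_2F1 :: "complex \<Rightarrow> complex \<Rightarrow> complex \<Rightarrow> complex \<Rightarrow> complex" where
  "gauss_2F1 a b c x = eval_fps (fps_hypergeo [a, b] [c] 1) x"

(* The right-hand side of the closed formula. It equals zernike_gen at -t, not at t: for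
   n = 0 and \<rho> = 0 one has frac_zernike \<kappa> 0 m 0 z = pochhammer (\<kappa> + 1) m * cnj z ^ m, so
   zernike_gen at t is (1 - t * cnj z * w) powr (-\<kappa> - 1), whereas the expression below is
   (1 + t * cnj z * w) powr (-\<kappa> - 1). *)

definition zernike_closed ::
  "real \<Rightarrow> real \<Rightarrow> int \<Rightarrow> complex \<Rightarrow> complex \<Rightarrow> complex \<Rightarrow> complex" where
  "zernike_closed \<kappa> \<rho> n z w t =
     (z * cnj w) powi n
     * (1 + t * w / z) powr of_real (of_int n + \<rho>)
     * (1 + t * cnj z / cnj w) powr of_real (of_int n + \<rho>)
     / (1 + t * cnj z * w) powr of_real (2 * (of_int n + \<rho>) + \<kappa> + 1)
     * gauss_2F1 (of_real (- of_int n - \<rho>)) (of_real (- of_int n - \<rho>)) (of_real (\<kappa> + 1))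
         (- (t * of_real (1 - (cmod z)\<^sup>2) * of_real (1 - (cmod w)\<^sup>2)
             / ((z + t * w) * (cnj w + t * cnj z))))"

end

theory Submission
  imports Defs "HOL-Complex_Analysis.Laurent_Convergence"
begin

text \<open>
  Writing \<open>b = - n - \<rho>\<close>, \<open>c = \<kappa> + 1\<close> and \<open>x = (1 - |z|\<^sup>2) / |z|\<^sup>2\<close>, the Leibniz rule gives
  \<open>Z\<^sub>m(z) = z\<^sup>n (c)\<^sub>m cnj z\<^sup>m M\<^sub>m(x)\<close>, where \<open>M\<^sub>m(x) = \<^sub>2F\<^sub>1(- m, b; c; - x)\<close> is a Meixner polynomial
  (\<open>frac_zernike_eq_meixner\<close>). With \<open>y = (1 - |w|\<^sup>2) / |w|\<^sup>2\<close> and \<open>s = t \<cdot> cnj z \<cdot> w\<close>, the series in question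
  is therefore \<open>(z \<cdot> cnj w)\<^sup>n\<close> times the bilinear generating function
  \<open>\<Sum>\<^sub>m (c)\<^sub>m / m! \<cdot> M\<^sub>m(x) M\<^sub>m(y) s\<^sup>m\<close>. Because \<open>1 + x = 1 / |z|\<^sup>2\<close>, the factors \<open>1 - (1 + x) s\<close> and
  \<open>1 - (1 + y) s\<close> are \<open>1 - t w / z\<close> and \<open>1 - t \<cdot> cnj z / cnj w\<close>, and the theorem becomes the bilinear formula

  \<open>\<Sum>\<^sub>m (c)\<^sub>m / m! \<cdot> M\<^sub>m(x) M\<^sub>m(y) s\<^sup>m = (1 - (1 + x) s)\<^sup>-\<^sup>b (1 - (1 + y) s)\<^sup>-\<^sup>b (1 - s)\<^sup>2\<^sup>b\<^sup>-\<^sup>c \<^sub>2F\<^sub>1(b, b; c; X)\<close>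

  with \<open>X = x y s / ((1 - (1 + x) s) (1 - (1 + y) s))\<close>.

  This formula is first proved for formal power series in \<open>s\<close> (\<open>meixner_bilinear_nth\<close>). Let
  \<open>g = (1 - s)\<^sup>b\<^sup>-\<^sup>c (1 - (1 + y) s)\<^sup>-\<^sup>b\<close>, which generates the numbers \<open>(c)\<^sub>m / m! \<cdot> M\<^sub>m(y)\<close>
  (\<open>meixner_gen_nth\<close>). The coefficient of \<open>x\<^sup>i\<close> in the left-hand side is a multiple of \<open>s\<^sup>i\<close> times
  the \<open>i\<close>-th derivative of \<open>g\<close>, because the coefficient of \<open>x\<^sup>i\<close> in \<open>M\<^sub>m(x)\<close> depends on \<open>m\<close> only through
  the binomial coefficient of \<open>m\<close> over \<open>i\<close>. That derivative is a finite sum over \<open>k\<close> with explicit coefficients (\<open>fps_deriv_iter_geom_pow\<close>), and the same sum appears on the right when the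
  hypergeometric series and the powers of \<open>1 - (1 + x) s\<close> are expanded in \<open>x\<close>.
  The right-hand side is analytic near \<open>s = 0\<close>, so the formal identity is an identity of convergent
  series for small \<open>s\<close> (\<open>meixner_bilinear_sums\<close>).
\<close>

unbundle fps_syntax
unbundle no vec_syntax

section \<open>Binomial power series and their derivatives\<close>

lemma sum_triangle_swap:
  fixes f :: "nat \<Rightarrow> nat \<Rightarrow> 'a::comm_monoid_add"
  shows "(\<Sum>l\<le>m. \<Sum>p\<le>m - l. f l p) = (\<Sum>p\<le>m. \<Sum>l\<le>m - p. f l p)"
proof -
  have *: "{..m - l} = {p\<in>{..m}. l + p \<le> m}" if "l \<le> m" for l
    using that by auto
  have **: "{..m - p} = {l\<in>{..m}. l + p \<le> m}" if "p \<le> m" for p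
    using that by auto
  have "(\<Sum>l\<le>m. \<Sum>p\<le>m - l. f l p) = (\<Sum>l\<le>m. \<Sum>p | p \<in> {..m} \<and> l + p \<le> m. f l p)"
    by (rule sum.cong) (simp_all add: *)
  also have "\<dots> = (\<Sum>p\<le>m. \<Sum>l | l \<in> {..m} \<and> l + p \<le> m. f l p)"
    by (rule sum.swap_restrict) auto
  also have "\<dots> = (\<Sum>p\<le>m. \<Sum>l\<le>m - p. f l p)"
    by (rule sum.cong) (simp_all add: **)
  finally show ?thesis .
qed

lemma sum_triangle_diagonal:
  fixes f :: "nat \<Rightarrow> nat \<Rightarrow> 'a::comm_monoid_add"
  shows "(\<Sum>k\<le>m. \<Sum>p\<le>m - k. f k p) = (\<Sum>i\<le>m. \<Sum>k\<le>i. f k (i - k))"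
proof -
  have "(SIGMA k:{..m}. {..m - k}) = {(k, p). k + p \<le> m}"
    by auto
  then show ?thesis
    using sum.triangle_reindex_eq[of f m] by (simp add: sum.Sigma)
qed

lemma fps_mult_nth_atMost: "(f * g) $ n = (\<Sum>i\<le>n. f $ i * g $ (n - i))"
  for f g :: "'a::comm_semiring_0 fps"
  by (simp add: fps_mult_nth atMost_atLeast0)

text \<open>
  The formal binomial series of \<open>(1 - x s)\<^sup>-\<^sup>b\<close> in the variable \<open>s\<close>. The negative exponent makes
  the coefficients Pochhammer symbols without signs.
\<close>
definition geom_pow :: "'a::field_char_0 \<Rightarrow> 'a \<Rightarrow> 'a fps" where
  "geom_pow b x = Abs_fps (\<lambda>m. pochhammer b m / fact m * x ^ m)"

lemma geom_pow_nth [simp]: "geom_pow b x $ m = pochhammer b m / fact m * x ^ m"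
  by (simp add: geom_pow_def)

lemma geom_pow_0 [simp]: "geom_pow 0 x = 1"
  by (simp add: fps_eq_iff pochhammer_0_left)

lemma geom_pow_mult: "geom_pow b x * geom_pow b' x = geom_pow (b + b') x"
proof (rule fps_ext)
  fix m
  have "(geom_pow b x * geom_pow b' x) $ m
      = (\<Sum>i\<le>m. of_nat (m choose i) * pochhammer b i * pochhammer b' (m - i) / fact m * x ^ m)"
    unfolding fps_mult_nth_atMost
    by (rule sum.cong) (auto simp: binomial_fact power_add[symmetric] field_simps)
  also have "\<dots> = geom_pow (b + b') x $ m"
    by (simp add: pochhammer_binomial_sum sum_divide_distrib sum_distrib_right mult.assoc)
  finally show "(geom_pow b x * geom_pow b' x) $ m = geom_pow (b + b') x $ m" .
qed

lemma geom_pow_power: "geom_pow b x ^ k = geom_pow (of_nat k * b) x"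
  by (induction k) (simp_all add: geom_pow_mult algebra_simps)

lemma geom_pow_minus_1: "geom_pow (- 1) x = 1 - fps_const x * fps_X"
proof (rule fps_ext)
  fix m
  have "pochhammer (- 1 :: 'a) m = 0" if "m > 1"
    using that pochhammer_of_nat_eq_0_lemma[of 1 m, where 'a='a] by simp
  then show "geom_pow (- 1) x $ m = (1 - fps_const x * fps_X) $ m"
    by (cases "m = 0"; cases "m = 1") auto
qed

lemma geom_pow_shift: "geom_pow b x = (1 - fps_const x * fps_X) * geom_pow (b + 1) x"
  using geom_pow_mult[of "- 1" x "b + 1"] by (simp add: geom_pow_minus_1)

lemma fps_deriv_geom_pow: "fps_deriv (geom_pow b x) = fps_const (b * x) * geom_pow (b + 1) x"
  by (rule fps_ext) (simp add: pochhammer_rec field_simps del: of_nat_Suc)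

text \<open>
  Taylor expansion in \<open>y\<close>, since the \<open>p\<close>-th derivative of \<open>(1 - (x + y) s)\<^sup>-\<^sup>b\<close> with respect to \<open>y\<close>
  at \<open>0\<close> is \<open>(b)\<^sub>p s\<^sup>p (1 - x s)\<^sup>-\<^sup>b\<^sup>-\<^sup>p\<close>. The factor \<open>s\<^sup>p\<close> cuts the sum off at \<open>p = m\<close> in
  the coefficient of \<open>s\<^sup>m\<close>; the arbitrary cofactor \<open>F\<close> lets the expansion be used inside products.
\<close>
lemma geom_pow_add_nth:
  "(F * geom_pow b (x + y)) $ m
     = (\<Sum>p\<le>m. pochhammer b p / fact p * y ^ p * (F * geom_pow (b + of_nat p) x) $ (m - p))"
proof -
  have expand: "geom_pow b (x + y) $ l
      = (\<Sum>p\<le>l. pochhammer b p / fact p * y ^ p * geom_pow (b + of_nat p) x $ (l - p))" for l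
  proof -
    have "geom_pow b (x + y) $ l
        = (\<Sum>p\<le>l. pochhammer b l / fact l * (of_nat (l choose p) * y ^ p * x ^ (l - p)))"
      by (simp add: add.commute[of x y] binomial_ring sum_distrib_left)
    also have "\<dots> = (\<Sum>p\<le>l. pochhammer b p / fact p * y ^ p * geom_pow (b + of_nat p) x $ (l - p))"
      by (rule sum.cong) (auto simp: binomial_fact pochhammer_product[where z=b and n=l] field_simps)
    finally show ?thesis .
  qed
  have "(F * geom_pow b (x + y)) $ m
      = (\<Sum>l\<le>m. \<Sum>p\<le>m - l. pochhammer b p / fact p * y ^ p
           * (F $ l * geom_pow (b + of_nat p) x $ (m - l - p)))"
    unfolding fps_mult_nth_atMost expand sum_distrib_left
    by (intro sum.cong) (simp_all del: geom_pow_nth add: mult_ac)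
  also have "\<dots> = (\<Sum>p\<le>m. \<Sum>l\<le>m - p. pochhammer b p / fact p * y ^ p
           * (F $ l * geom_pow (b + of_nat p) x $ (m - l - p)))"
    by (rule sum_triangle_swap)
  also have "\<dots> = (\<Sum>p\<le>m. pochhammer b p / fact p * y ^ p * (F * geom_pow (b + of_nat p) x) $ (m - p))"
    unfolding fps_mult_nth_atMost sum_distrib_left
    by (intro sum.cong) (simp_all del: geom_pow_nth add: add.commute)
  finally show ?thesis .
qed

text \<open>
  This is the combinatorial heart of the bilinear formula. With \<open>A = 1 - s\<close> and \<open>B = 1 - (1 + y) s\<close>,
  the identity \<open>(1 + y) A = B + y\<close> turns the derivative of \<open>A\<^sup>-\<^sup>e B\<^sup>-\<^sup>f\<close> into a combination of
  \<open>A\<^sup>-\<^sup>e\<^sup>-\<^sup>1 B\<^sup>-\<^sup>f\<close> and \<open>A\<^sup>-\<^sup>e\<^sup>-\<^sup>1 B\<^sup>-\<^sup>f\<^sup>-\<^sup>1\<close>. All terms of the \<open>i\<close>-th derivative therefore carry the same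
  power of \<open>A\<close>, and the coefficients obey a Pascal-like recurrence whose solution is a binomial
  coefficient times Pochhammer symbols. The Leibniz rule would produce powers of \<open>1 + y\<close> instead of
  the powers of \<open>y\<close> that occur in the hypergeometric series.
\<close>
lemma fps_deriv_iter_geom_pow:
  fixes b c y :: "'a::field_char_0"
  shows "(fps_deriv ^^ i) (geom_pow (c - b) 1 * geom_pow b (1 + y))
    = (\<Sum>k\<le>i. fps_const (of_nat (i choose k) * pochhammer b k * pochhammer (c + of_nat k) (i - k) * y ^ k)
          * (geom_pow (c - b + of_nat i) 1 * geom_pow (b + of_nat k) (1 + y)))"
proof (induction i)
  case 0
  show ?case by simp
next
  case (Suc i)
  define E where "E i k = geom_pow (c - b + of_nat i) 1 * geom_pow (b + of_nat k) (1 + y)" for i k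
  define q where "q i k = of_nat (i choose k) * pochhammer b k * pochhammer (c + of_nat k) (i - k) * y ^ k"
    for i k
  have dE: "fps_deriv (E i k) = fps_const (c + of_nat i + of_nat k) * E (Suc i) k
              + fps_const ((b + of_nat k) * y) * E (Suc i) (Suc k)" for k
  proof -
    define P where "P = geom_pow (c - b + of_nat (Suc i)) 1"
    define Q where "Q = geom_pow (b + of_nat (Suc k)) (1 + y)"
    have P: "geom_pow (c - b + of_nat i) 1 = (1 - fps_X) * P"
      using geom_pow_shift[of "c - b + of_nat i" 1] by (simp add: P_def add_ac)
    have one_y: "fps_const (1 + y) = 1 + fps_const y"
      by (metis fps_const_1_eq_1 fps_const_add)
    have Q: "geom_pow (b + of_nat k) (1 + y) = (1 - (1 + fps_const y) * fps_X) * Q"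
      using geom_pow_shift[of "b + of_nat k" "1 + y"] unfolding one_y by (simp add: Q_def add_ac)
    have "fps_deriv (geom_pow (c - b + of_nat i) 1) = fps_const (c - b + of_nat i) * P"
      using fps_deriv_geom_pow[of "c - b + of_nat i" 1] by (simp add: P_def add_ac)
    moreover have "fps_const (c - b + of_nat i)
        = fps_const (c + of_nat k) - fps_const (b + of_nat k) + fps_const (of_nat i)"
      by simp
    ultimately have dP: "fps_deriv (geom_pow (c - b + of_nat i) 1)
        = (fps_const (c + of_nat k) - fps_const (b + of_nat k) + fps_const (of_nat i)) * P"
      by (simp only:)
    have "fps_deriv (geom_pow (b + of_nat k) (1 + y)) = fps_const ((b + of_nat k) * (1 + y)) * Q"
      using fps_deriv_geom_pow[of "b + of_nat k" "1 + y"] by (simp add: Q_def add_ac)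
    moreover have "fps_const ((b + of_nat k) * (1 + y)) = fps_const (b + of_nat k) * (1 + fps_const y)"
      unfolding one_y[symmetric] by simp
    ultimately have dQ: "fps_deriv (geom_pow (b + of_nat k) (1 + y))
        = fps_const (b + of_nat k) * (1 + fps_const y) * Q"
      by (simp only:)
    have const_add: "fps_const (c + of_nat k) + fps_const (of_nat i) = fps_const (c + of_nat i + of_nat k)"
      by (simp add: add_ac)
    have ring: "(1 - X) * P * (B * (1 + Y) * Q) + (C - B + I) * P * ((1 - (1 + Y) * X) * Q)
        = (C + I) * (P * ((1 - (1 + Y) * X) * Q)) + B * Y * (P * Q)" for B C I X Y P Q :: "'a fps"
      by algebra
    have "fps_deriv (E i k)
        = (1 - fps_X) * P * (fps_const (b + of_nat k) * (1 + fps_const y) * Q)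
          + (fps_const (c + of_nat k) - fps_const (b + of_nat k) + fps_const (of_nat i)) * P
            * ((1 - (1 + fps_const y) * fps_X) * Q)"
      unfolding E_def fps_deriv_mult dP dQ unfolding P Q ..
    also have "\<dots> = (fps_const (c + of_nat k) + fps_const (of_nat i))
            * (P * ((1 - (1 + fps_const y) * fps_X) * Q))
          + fps_const (b + of_nat k) * fps_const y * (P * Q)"
      by (rule ring)
    also have "\<dots> = fps_const (c + of_nat i + of_nat k) * E (Suc i) k
              + fps_const ((b + of_nat k) * y) * E (Suc i) (Suc k)"
      unfolding E_def P_def[symmetric] Q_def[symmetric] Q const_add fps_const_mult ..
    finally show ?thesis .
  qed
  have coeff: "q i k * (c + of_nat i + of_nat k) + q i (k - 1) * ((b + of_nat (k - 1)) * y) * of_bool (k > 0)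
       = q (Suc i) k" if "k \<le> Suc i" for k
  proof (cases k)
    case 0
    then show ?thesis by (simp add: q_def pochhammer_Suc mult_ac add_ac)
  next
    case (Suc l)
    show ?thesis
    proof (cases "l = i")
      case True
      then show ?thesis using Suc by (simp add: q_def pochhammer_Suc binomial_eq_0 mult_ac)
    next
      case False
      then have "l < i"
        using that Suc by simp
      then obtain d where i: "i = Suc (l + d)"
        using less_imp_Suc_add by blast
      have "i - l = Suc d"
        by (simp add: i)
      then have "Suc l * (i choose Suc l) = Suc d * (i choose l)"
        by (metis binomial_absorb_comp binomial_absorption)
      then have "of_nat (Suc l * (i choose Suc l)) = (of_nat (Suc d * (i choose l)) :: 'a)"
        by (simp only:)
      then have nat: "(of_nat l + 1) * of_nat (i choose Suc l) = (of_nat d + 1) * (of_nat (i choose l) :: 'a)"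
        by (simp only: of_nat_mult of_nat_Suc add.commute)
      have p1: "pochhammer (c + of_nat l) (i - l) = (c + of_nat l) * pochhammer (c + of_nat l + 1) d"
        by (simp add: i Suc_diff_le pochhammer_rec)
      have p2: "pochhammer (c + of_nat k) (Suc i - k)
          = pochhammer (c + of_nat l + 1) d * (c + of_nat l + 1 + of_nat d)"
        by (simp add: i Suc Suc_diff_le pochhammer_Suc add_ac)
      have p3: "pochhammer (c + of_nat k) (i - k) = pochhammer (c + of_nat l + 1) d"
        by (simp add: i Suc add_ac)
      \<comment> \<open>The recurrence differs from Pascal's rule times \<open>c + i\<close> only by a multiple of the difference of
        the two sides of the absorption identity.\<close>
      have "of_nat (i choose Suc l) * (c + of_nat i + of_nat k) + of_nat (i choose l) * (c + of_nat l)
          = (of_nat (i choose Suc l) + of_nat (i choose l)) * (c + of_nat l + 1 + of_nat d)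
            + ((of_nat l + 1) * of_nat (i choose Suc l) - (of_nat d + 1) * (of_nat (i choose l) :: 'a))"
        unfolding i Suc by (simp add: algebra_simps)
      also have "\<dots> = of_nat (Suc i choose k) * (c + of_nat l + 1 + of_nat d)"
        unfolding nat by (simp add: Suc add.commute)
      finally have key: "of_nat (i choose Suc l) * (c + of_nat i + of_nat k) + of_nat (i choose l) * (c + of_nat l)
          = of_nat (Suc i choose k) * (c + of_nat l + 1 + of_nat d)" .
      have "q i k * (c + of_nat i + of_nat k) + q i (k - 1) * ((b + of_nat (k - 1)) * y) * of_bool (k > 0)
         = pochhammer b k * y ^ k * pochhammer (c + of_nat l + 1) d
           * (of_nat (i choose Suc l) * (c + of_nat i + of_nat k) + of_nat (i choose l) * (c + of_nat l))"
        unfolding q_def p3 using p1 by (simp add: Suc pochhammer_Suc algebra_simps)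
      also have "\<dots> = q (Suc i) k"
        unfolding key q_def p2 by (simp add: mult_ac)
      finally show ?thesis .
    qed
  qed
  have "(fps_deriv ^^ Suc i) (geom_pow (c - b) 1 * geom_pow b (1 + y))
      = fps_deriv (\<Sum>k\<le>i. fps_const (q i k) * E i k)"
    using Suc.IH by (simp add: q_def E_def)
  also have "\<dots> = (\<Sum>k\<le>i. fps_const (q i k) * fps_deriv (E i k))"
    by (simp add: fps_deriv_sum)
  also have "\<dots> = (\<Sum>k\<le>i. fps_const (q i k * (c + of_nat i + of_nat k)) * E (Suc i) k)
      + (\<Sum>k\<le>i. fps_const (q i k * ((b + of_nat k) * y)) * E (Suc i) (Suc k))"
    unfolding dE distrib_left sum.distrib mult.assoc[symmetric] fps_const_mult ..
  also have "(\<Sum>k\<le>i. fps_const (q i k * (c + of_nat i + of_nat k)) * E (Suc i) k)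
      = (\<Sum>k\<le>Suc i. fps_const (q i k * (c + of_nat i + of_nat k)) * E (Suc i) k)"
    by (simp add: q_def binomial_eq_0)
  also have "(\<Sum>k\<le>i. fps_const (q i k * ((b + of_nat k) * y)) * E (Suc i) (Suc k))
      = (\<Sum>k\<le>Suc i. fps_const (q i (k - 1) * ((b + of_nat (k - 1)) * y) * of_bool (k > 0)) * E (Suc i) k)"
    by (subst sum.atMost_Suc_shift) simp
  also have "(\<Sum>k\<le>Suc i. fps_const (q i k * (c + of_nat i + of_nat k)) * E (Suc i) k) + \<dots>
      = (\<Sum>k\<le>Suc i. fps_const (q (Suc i) k) * E (Suc i) k)"
    unfolding sum.distrib[symmetric] distrib_right[symmetric] fps_const_add
    by (intro sum.cong) (simp_all only: coeff atMost_iff)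
  finally show ?case by (simp only: q_def E_def)
qed

section \<open>Meixner polynomials and their bilinear generating function\<close>

text \<open>
  The value \<open>\<^sub>2F\<^sub>1(- m, b; c; - x)\<close>, a Meixner polynomial of degree \<open>m\<close> in the usual notation when \<open>- b\<close>
  is its argument and \<open>x\<close> encodes its second parameter.
\<close>
definition meixner :: "'a::field_char_0 \<Rightarrow> 'a \<Rightarrow> nat \<Rightarrow> 'a \<Rightarrow> 'a" where
  "meixner b c m x = (\<Sum>p\<le>m. of_nat (m choose p) * pochhammer b p / pochhammer c p * x ^ p)"

text \<open>
  The ordinary generating function
  \<open>(1 - s)\<^sup>b\<^sup>-\<^sup>c (1 - (1 + y) s)\<^sup>-\<^sup>b\<close> of the Meixner polynomials, obtained by expanding the second factor in \<open>y\<close>.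
\<close>
lemma meixner_gen_nth:
  assumes c: "\<And>k. pochhammer c k \<noteq> 0"
  shows "(geom_pow (c - b) 1 * geom_pow b (1 + y)) $ m = pochhammer c m / fact m * meixner b c m y"
proof -
  have "(geom_pow (c - b) 1 * geom_pow b (1 + y)) $ m
      = (\<Sum>p\<le>m. pochhammer b p / fact p * y ^ p * geom_pow (c + of_nat p) 1 $ (m - p))"
    by (subst geom_pow_add_nth) (simp add: geom_pow_mult algebra_simps)
  also have "\<dots> = (\<Sum>p\<le>m. pochhammer c m / fact m
      * (of_nat (m choose p) * pochhammer b p / pochhammer c p * y ^ p))"
    by (rule sum.cong) (use c in \<open>auto simp: pochhammer_product[where z=c and n=m] binomial_fact field_simps\<close>)
  finally show ?thesis by (simp add: meixner_def sum_distrib_left)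
qed

text \<open>
  Since \<open>G\<close> has no constant term, only the powers \<open>G\<^sup>k\<close> with \<open>k \<le> m\<close> reach the coefficient of \<open>s\<^sup>m\<close>,
  so the infinite sum \<open>H(G)\<close> may be multiplied out termwise.
\<close>
lemma fps_mult_compose_nth:
  fixes A H G :: "'a::comm_ring_1 fps"
  assumes "G $ 0 = 0"
  shows "(A * (H oo G)) $ m = (\<Sum>k\<le>m. H $ k * (A * G ^ k) $ m)"
proof -
  have low: "(G ^ k) $ l = 0" if "l < k" for k l
    using assms that startsby_zero_power_prefix by blast
  have "(H oo G) $ l = (\<Sum>k\<le>m. H $ k * (G ^ k) $ l)" if "l \<le> m" for l
    unfolding fps_compose_nth by (rule sum.mono_neutral_left) (use that low in auto)
  then have "(A * (H oo G)) $ m = (\<Sum>l\<le>m. \<Sum>k\<le>m. H $ k * (A $ l * (G ^ k) $ (m - l)))"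
    by (simp add: fps_mult_nth_atMost sum_distrib_left mult_ac)
  also have "\<dots> = (\<Sum>k\<le>m. H $ k * (A * G ^ k) $ m)"
    by (subst sum.swap) (simp add: fps_mult_nth_atMost sum_distrib_left)
  finally show ?thesis .
qed

lemma fps_deriv_iter_nth:
  "(fps_deriv ^^ i) f $ l = fact (l + i) / fact l * f $ (l + i)" for f :: "'a::field_char_0 fps"
proof (induction i arbitrary: l)
  case (Suc i)
  show ?case
    using Suc.IH[of "Suc l"] by (simp add: divide_simps del: of_nat_Suc) (simp add: mult_ac)
qed simp

text \<open>
  The bilinear generating function as an identity of formal power series. On the left the
  hypergeometric series is expanded in \<open>k\<close> and each remaining power of \<open>1 - (1 + x) s\<close> in \<open>x\<close> with
  index \<open>p\<close>. For a fixed power \<open>x\<^sup>i\<close>, \<open>i = k + p\<close>, the sum over \<open>k\<close> is exactly the \<open>i\<close>-th derivative of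
  the generating function \<open>g\<close> of the polynomials in \<open>y\<close>. Taking the coefficient of \<open>s\<^sup>m\<^sup>-\<^sup>i\<close> of that derivative produces
  the falling factorial that is needed for the binomial coefficient of the polynomial in \<open>x\<close>.
\<close>
lemma meixner_bilinear_nth:
  fixes b c x y :: "'a::field_char_0"
  assumes c: "\<And>k. pochhammer c k \<noteq> 0"
  shows "(geom_pow b (1 + x) * geom_pow b (1 + y) * geom_pow (c - 2 * b) 1
           * (fps_hypergeo [b, b] [c] 1
               oo fps_const (x * y) * fps_X * geom_pow 1 (1 + x) * geom_pow 1 (1 + y))) $ m
         = pochhammer c m / fact m * meixner b c m x * meixner b c m y"
proof -
  define A where "A = geom_pow b (1 + x) * geom_pow b (1 + y) * geom_pow (c - 2 * b) 1"
  define G where "G = fps_const (x * y) * fps_X * geom_pow 1 (1 + x) * geom_pow 1 (1 + y)"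
  define H where "H = fps_hypergeo [b, b] [c] 1"
  define g where "g = geom_pow (c - b) 1 * geom_pow b (1 + y)"
  define e where "e i = pochhammer b i / (fact i * pochhammer c i)" for i
  define B where "B i k = (geom_pow (c - b + of_nat i) 1 * geom_pow (b + of_nat k) (1 + y)) $ (m - i)" for i k
  \<comment> \<open>Expanding only the factors that involve \<open>x\<close>; the powers of \<open>1 - s\<close> combine to the exponent
    \<open>b - c - (k + p)\<close>, which depends on \<open>k + p\<close> alone.\<close>
  have AG: "(A * G ^ k) $ m = (x * y) ^ k * (\<Sum>p\<le>m - k. pochhammer (b + of_nat k) p / fact p * x ^ p
               * B (k + p) k)" if "k \<le> m" for k
  proof -
    have merge: "geom_pow (b + of_nat k) (1 + y) * geom_pow (c - 2 * b) 1 * geom_pow (b + of_nat k + of_nat p) 1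
        = geom_pow (c - b + of_nat (k + p)) 1 * geom_pow (b + of_nat k) (1 + y)" for p
    proof -
      have "(c - 2 * b) + (b + of_nat k + of_nat p) = c - b + of_nat (k + p)" by simp
      then show ?thesis
        using geom_pow_mult[of "c - 2 * b" 1 "b + of_nat k + of_nat p"] by (simp only: mult_ac)
    qed
    have "A * G ^ k = fps_const ((x * y) ^ k) * (fps_X ^ k *
        ((geom_pow (b + of_nat k) (1 + y) * geom_pow (c - 2 * b) 1) * geom_pow (b + of_nat k) (1 + x)))"
      unfolding A_def G_def power_mult_distrib geom_pow_power fps_const_power
      by (simp add: geom_pow_mult[symmetric] mult_ac)
    then have "(A * G ^ k) $ m = (x * y) ^ k *
        ((geom_pow (b + of_nat k) (1 + y) * geom_pow (c - 2 * b) 1) * geom_pow (b + of_nat k) (1 + x)) $ (m - k)"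
      using that by (simp add: fps_X_power_mult_nth del: geom_pow_nth)
    also have "\<dots> = (x * y) ^ k * (\<Sum>p\<le>m - k. pochhammer (b + of_nat k) p / fact p * x ^ p
               * B (k + p) k)"
      unfolding geom_pow_add_nth[where x=1 and y=x] merge B_def by simp
    finally show ?thesis .
  qed
  have "(A * (H oo G)) $ m = (\<Sum>k\<le>m. H $ k * (A * G ^ k) $ m)"
    by (rule fps_mult_compose_nth) (simp add: G_def)
  also have "\<dots> = (\<Sum>k\<le>m. \<Sum>p\<le>m - k. e k * y ^ k * (pochhammer b (k + p) / fact p)
               * x ^ (k + p) * B (k + p) k)"
    by (intro sum.cong)
       (simp_all add: AG H_def e_def sum_distrib_left pochhammer_product' power_add power_mult_distrib field_simps)
  also have "\<dots> = (\<Sum>i\<le>m. \<Sum>k\<le>i. e k * y ^ k * (pochhammer b i / fact (i - k)) * x ^ i * B i k)"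
    by (subst sum_triangle_diagonal) simp
  also have "\<dots> = (\<Sum>i\<le>m. e i * x ^ i * (fps_deriv ^^ i) g $ (m - i))"
  proof (rule sum.cong)
    fix i assume "i \<in> {..m}"
    have "e i * x ^ i * (fps_deriv ^^ i) g $ (m - i) = (\<Sum>k\<le>i. e i * x ^ i *
        (of_nat (i choose k) * pochhammer b k * pochhammer (c + of_nat k) (i - k) * y ^ k * B i k))"
      unfolding g_def fps_deriv_iter_geom_pow fps_sum_nth B_def by (simp add: sum_distrib_left)
    also have "\<dots> = (\<Sum>k\<le>i. e k * y ^ k * (pochhammer b i / fact (i - k)) * x ^ i * B i k)"
    proof (rule sum.cong)
      fix k assume "k \<in> {..i}"
      then have "pochhammer c i = pochhammer c k * pochhammer (c + of_nat k) (i - k)"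
        by (simp add: pochhammer_product)
      moreover have "pochhammer c i \<noteq> 0" "pochhammer c k \<noteq> 0" using c by auto
      ultimately show "e i * x ^ i * (of_nat (i choose k) * pochhammer b k
            * pochhammer (c + of_nat k) (i - k) * y ^ k * B i k)
          = e k * y ^ k * (pochhammer b i / fact (i - k)) * x ^ i * B i k"
        using \<open>k \<in> {..i}\<close> by (simp add: e_def binomial_fact field_simps)
    qed simp
    finally show "(\<Sum>k\<le>i. e k * y ^ k * (pochhammer b i / fact (i - k)) * x ^ i * B i k)
        = e i * x ^ i * (fps_deriv ^^ i) g $ (m - i)" by simp
  qed simp
  also have "\<dots> = (\<Sum>i\<le>m. (of_nat (m choose i) * pochhammer b i / pochhammer c i * x ^ i) * g $ m)"
    by (rule sum.cong) (simp_all add: fps_deriv_iter_nth e_def binomial_fact field_simps)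
  also have "\<dots> = meixner b c m x * g $ m"
    by (simp add: meixner_def sum_distrib_right)
  also have "g $ m = pochhammer c m / fact m * meixner b c m y"
    unfolding g_def using c by (rule meixner_gen_nth)
  finally show ?thesis by (simp add: A_def G_def H_def mult_ac)
qed

section \<open>Zernike functions as Meixner polynomials\<close>

text \<open>
  The real derivative of a function splits uniquely into a complex linear and an antilinear part,
  and the Wirtinger derivative is the coefficient \<open>A\<close> of the linear one. Passing to a function that
  agrees with \<open>f\<close> only on an open set is what allows iterated derivatives to be computed by induction.
\<close>
lemma wirtinger_eqI:
  assumes g: "(g has_derivative (\<lambda>h. A * h + B * cnj h)) (at u)"
    and U: "open U" "u \<in> U" "\<And>v. v \<in> U \<Longrightarrow> g v = f v"
  shows "wirtinger f u = A"
proof -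
  have f: "(f has_derivative (\<lambda>h. A * h + B * cnj h)) (at u)"
    using g U by (rule has_derivative_transform_within_open)
  have "((\<lambda>x. f (u + of_real x)) has_derivative (\<lambda>x. A * of_real x + B * cnj (of_real x))) (at (0::real))"
    by (rule has_derivative_compose[of "\<lambda>x. u + of_real x" of_real])
       (use f in \<open>auto intro!: derivative_eq_intros\<close>)
  then have x: "vector_derivative (\<lambda>x. f (u + of_real x)) (at (0::real)) = A + B"
    by (intro vector_derivative_at)
       (simp add: has_vector_derivative_def scaleR_conv_of_real algebra_simps)
  have "((\<lambda>y. f (u + \<i> * of_real y)) has_derivative
          (\<lambda>y. A * (\<i> * of_real y) + B * cnj (\<i> * of_real y))) (at (0::real))"
    by (rule has_derivative_compose[of "\<lambda>y. u + \<i> * of_real y" "\<lambda>y. \<i> * of_real y"])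
       (use f in \<open>auto intro!: derivative_eq_intros\<close>)
  then have y: "vector_derivative (\<lambda>y. f (u + \<i> * of_real y)) (at (0::real)) = \<i> * A - \<i> * B"
    by (intro vector_derivative_at)
       (simp add: has_vector_derivative_def scaleR_conv_of_real algebra_simps)
  show ?thesis
    unfolding wirtinger_def x y by (simp add: algebra_simps)
qed

text \<open>
  The part of the unit disc on which the logarithm based at \<open>z\<close> is holomorphic. The origin is excluded
  automatically because \<open>0 / z = 0\<close> lies on the cut.
\<close>
definition slit_disc :: "complex \<Rightarrow> complex set" where
  "slit_disc z = {u. u / z \<notin> \<real>\<^sub>\<le>\<^sub>0 \<and> cmod u < 1}"

lemma open_slit_disc:
  assumes "z \<noteq> 0"
  shows "open (slit_disc z)"
proof -
  have "slit_disc z = (\<lambda>u. u / z) -` (- \<real>\<^sub>\<le>\<^sub>0) \<inter> ball 0 1"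
    by (auto simp: slit_disc_def)
  moreover have "open ((\<lambda>u. u / z) -` (- \<real>\<^sub>\<le>\<^sub>0))"
    by (rule open_vimage) (use assms in \<open>auto intro!: continuous_intros\<close>)
  ultimately show ?thesis by auto
qed

text \<open>
  The functions \<open>u\<^sup>p \<cdot> cnj u\<^sup>q \<cdot> (1 - u \<cdot> cnj u)\<^sup>r\<close>, whose linear span contains all the Wirtinger derivatives of the
  function that defines a Zernike function.
\<close>
definition disc_monom :: "complex \<Rightarrow> real \<Rightarrow> nat \<Rightarrow> real \<Rightarrow> complex \<Rightarrow> complex" where
  "disc_monom z p q r u = local_powr z p u * cnj u ^ q * of_real ((1 - (cmod u)\<^sup>2) powr r)"

lemma local_powr_diff_1:
  assumes "z \<noteq> 0" "u \<noteq> 0"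
  shows "local_powr z (p - 1) u = local_powr z p u / u"
proof -
  have "exp (local_ln z u) = u"
    using assms by (simp add: local_ln_def exp_add)
  then show ?thesis
    by (simp add: local_powr_def algebra_simps exp_diff)
qed

text \<open>
  The linear part is what one gets by differentiating in \<open>u\<close> with \<open>cnj u\<close> held constant. The antilinear
  coefficient \<open>B\<close> is left unspecified because the Wirtinger derivative ignores it.
\<close>
lemma disc_monom_has_derivative:
  assumes z: "z \<noteq> 0" and u: "u \<in> slit_disc z"
  shows "\<exists>B. (disc_monom z p q r has_derivative
           (\<lambda>h. (of_real p * disc_monom z (p - 1) q r u - of_real r * disc_monom z p (Suc q) (r - 1) u) * h
                + B * cnj h)) (at u)"
proof -
  have u0: "u \<noteq> 0" and u1: "cmod u < 1" and uz: "u / z \<notin> \<real>\<^sub>\<le>\<^sub>0"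
    using u by (auto simp: slit_disc_def)
  define R where "R = 1 - (cmod u)\<^sup>2"
  have R: "R > 0" using u1 by (simp add: R_def abs_square_less_1)
  have "(local_powr z p has_field_derivative (of_real p * local_powr z (p - 1) u)) (at u)"
    unfolding local_powr_diff_1[OF z u0] unfolding local_powr_def local_ln_def
    by (rule derivative_eq_intros refl uz | use z u0 in \<open>simp\<close>)+
  then have d1: "(local_powr z p has_derivative (\<lambda>h. of_real p * local_powr z (p - 1) u * h)) (at u)"
    by (simp add: has_field_derivative_def mult_commute_abs)
  have d2: "((\<lambda>u. cnj u ^ q) has_derivative (\<lambda>h. of_nat q * cnj u ^ (q - 1) * cnj h)) (at u)"
    by (auto intro!: derivative_eq_intros has_derivative_power simp: mult_ac)
  have "((\<lambda>u. (1 - u \<bullet> u) powr r) has_derivative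
          (\<lambda>h. r * R powr (r - 1) * (- 2 * (u \<bullet> h)))) (at u)"
    using R by (auto intro!: derivative_eq_intros
        simp: R_def power2_norm_eq_inner inner_commute powr_diff field_simps)
  then have "((\<lambda>u. (1 - (cmod u)\<^sup>2) powr r) has_derivative
          (\<lambda>h. r * R powr (r - 1) * (- 2 * (u \<bullet> h)))) (at u)"
    by (simp add: power2_norm_eq_inner)
  then have "((\<lambda>u. complex_of_real ((1 - (cmod u)\<^sup>2) powr r)) has_derivative
          (\<lambda>h. of_real (r * R powr (r - 1) * (- 2 * (u \<bullet> h))))) (at u)"
    by (rule has_derivative_of_real)
  moreover have "of_real (r * R powr (r - 1) * (- 2 * (u \<bullet> h)))
      = - of_real (r * R powr (r - 1)) * (cnj u * h + u * cnj h)" for h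
    by (simp add: complex_eq_iff inner_complex_def algebra_simps)
  then have "(\<lambda>h. complex_of_real (r * R powr (r - 1) * (- 2 * (u \<bullet> h))))
      = (\<lambda>h. - of_real (r * R powr (r - 1)) * (cnj u * h + u * cnj h))"
    by (rule ext)
  ultimately have d3: "((\<lambda>u. complex_of_real ((1 - (cmod u)\<^sup>2) powr r)) has_derivative
          (\<lambda>h. - of_real (r * R powr (r - 1)) * (cnj u * h + u * cnj h))) (at u)"
    by (simp only:)
  define B where "B = local_powr z p u * (of_nat q * cnj u ^ (q - 1)) * of_real (R powr r)
      - local_powr z p u * cnj u ^ q * of_real (r * R powr (r - 1)) * u"
  have "(disc_monom z p q r has_derivative
           (\<lambda>h. (of_real p * disc_monom z (p - 1) q r u - of_real r * disc_monom z p (Suc q) (r - 1) u) * h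
                + B * cnj h)) (at u)"
    unfolding disc_monom_def
    by (rule has_derivative_eq_rhs[OF has_derivative_mult[OF has_derivative_mult[OF d1 d2] d3]])
       (rule ext, simp add: B_def R_def algebra_simps)
  then show ?thesis by blast
qed

lemma sum_Pascal:
  fixes Q :: "nat \<Rightarrow> nat \<Rightarrow> 'a::comm_semiring_1"
  shows "(\<Sum>i\<le>j. of_nat (j choose i) * (Q (Suc i) (j - i) + Q i (Suc (j - i))))
       = (\<Sum>i\<le>Suc j. of_nat (Suc j choose i) * Q i (Suc j - i))"
proof -
  have shift: "(\<Sum>i\<le>Suc j. of_nat (j choose i) * Q i (Suc j - i))
      = Q 0 (Suc j) + (\<Sum>i\<le>j. of_nat (j choose Suc i) * Q (Suc i) (j - i))"
    by (subst sum.atMost_Suc_shift) simp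
  have "(\<Sum>i\<le>Suc j. of_nat (Suc j choose i) * Q i (Suc j - i))
      = Q 0 (Suc j) + (\<Sum>i\<le>j. of_nat (j choose i) * Q (Suc i) (j - i))
        + (\<Sum>i\<le>j. of_nat (j choose Suc i) * Q (Suc i) (j - i))"
    by (subst sum.atMost_Suc_shift) (simp add: sum.distrib distrib_right add_ac)
  also have "Q 0 (Suc j) + (\<Sum>i\<le>j. of_nat (j choose i) * Q (Suc i) (j - i))
        + (\<Sum>i\<le>j. of_nat (j choose Suc i) * Q (Suc i) (j - i))
      = (\<Sum>i\<le>j. of_nat (j choose i) * Q (Suc i) (j - i))
        + (\<Sum>i\<le>Suc j. of_nat (j choose i) * Q i (Suc j - i))"
    by (subst shift) (simp add: add_ac)
  also have "(\<Sum>i\<le>Suc j. of_nat (j choose i) * Q i (Suc j - i))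
      = (\<Sum>i\<le>j. of_nat (j choose i) * Q i (Suc (j - i)))"
    by (simp add: binomial_eq_0 Suc_diff_le)
  finally show ?thesis by (simp add: sum.distrib distrib_left)
qed

text \<open>
  The Leibniz rule for \<open>u\<^sup>p (1 - u \<cdot> cnj u)\<^sup>r\<close>. The signed Pochhammer symbol \<open>(-1)\<^sup>i (- p)\<^sub>i\<close> is the falling factorial of \<open>p\<close>;
  the falling factorial of \<open>r\<close> loses its sign to the sign of the inner derivative \<open>- cnj u\<close>.
\<close>
lemma wirtinger_iter_disc_monom:
  assumes z: "z \<noteq> 0" and u: "u \<in> slit_disc z"
  shows "(wirtinger ^^ j) (disc_monom z p 0 r) u
    = (\<Sum>i\<le>j. of_nat (j choose i) * ((-1) ^ i
         * of_real (pochhammer (- p) i * pochhammer (- r) (j - i))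
         * disc_monom z (p - of_nat i) (j - i) (r - of_nat (j - i)) u))"
  using u
proof (induction j arbitrary: u)
  case 0
  then show ?case by simp
next
  case (Suc j)
  define Q where "Q i l v = (-1) ^ i * of_real (pochhammer (- p) i * pochhammer (- r) l)
         * disc_monom z (p - of_nat i) l (r - of_nat l) v" for i l v
  have dQ: "\<exists>B. (Q i l has_derivative (\<lambda>h. (Q (Suc i) l u + Q i (Suc l) u) * h + B * cnj h)) (at u)" for i l
  proof -
    define k where "k = (-1) ^ i * complex_of_real (pochhammer (- p) i * pochhammer (- r) l)"
    obtain B where "(disc_monom z (p - of_nat i) l (r - of_nat l) has_derivative
           (\<lambda>h. (of_real (p - of_nat i) * disc_monom z (p - of_nat i - 1) l (r - of_nat l) u
                 - of_real (r - of_nat l) * disc_monom z (p - of_nat i) (Suc l) (r - of_nat l - 1) u) * h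
                + B * cnj h)) (at u)"
      using disc_monom_has_derivative[OF z Suc.prems] by blast
    from has_derivative_mult_right[OF this, of k]
    have "(Q i l has_derivative (\<lambda>h. (Q (Suc i) l u + Q i (Suc l) u) * h + k * B * cnj h)) (at u)"
      unfolding Q_def k_def[symmetric]
      by (rule has_derivative_eq_rhs)
         (rule ext, simp add: k_def pochhammer_Suc algebra_simps)
    then show ?thesis by blast
  qed
  then obtain B where B: "\<And>i l. (Q i l has_derivative
      (\<lambda>h. (Q (Suc i) l u + Q i (Suc l) u) * h + B i l * cnj h)) (at u)"
    by metis
  have collect: "(\<Sum>i\<le>j. f i * (g i * h + b i * k)) = (\<Sum>i\<le>j. f i * g i) * h + (\<Sum>i\<le>j. f i * b i) * k"
    for f g b :: "nat \<Rightarrow> complex" and h k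
    by (simp add: distrib_left sum.distrib sum_distrib_right mult.assoc)
  have "((\<lambda>v. \<Sum>i\<le>j. of_nat (j choose i) * Q i (j - i) v) has_derivative
      (\<lambda>h. \<Sum>i\<le>j. of_nat (j choose i)
          * ((Q (Suc i) (j - i) u + Q i (Suc (j - i)) u) * h + B i (j - i) * cnj h))) (at u)"
    by (intro has_derivative_sum has_derivative_mult_right B)
  then have "((\<lambda>v. \<Sum>i\<le>j. of_nat (j choose i) * Q i (j - i) v) has_derivative
      (\<lambda>h. (\<Sum>i\<le>j. of_nat (j choose i) * (Q (Suc i) (j - i) u + Q i (Suc (j - i)) u)) * h
         + (\<Sum>i\<le>j. of_nat (j choose i) * B i (j - i)) * cnj h)) (at u)"
    by (rule has_derivative_eq_rhs) (rule ext, rule collect)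
  then have "wirtinger ((wirtinger ^^ j) (disc_monom z p 0 r)) u
      = (\<Sum>i\<le>j. of_nat (j choose i) * (Q (Suc i) (j - i) u + Q i (Suc (j - i)) u))"
    by (rule wirtinger_eqI[OF _ open_slit_disc[OF z] Suc.prems]) (simp add: Suc.IH Q_def)
  also have "\<dots> = (\<Sum>i\<le>Suc j. of_nat (Suc j choose i) * Q i (Suc j - i) u)"
    by (rule sum_Pascal[where Q = "\<lambda>i l. Q i l u"])
  finally show ?case by (simp add: Q_def)
qed

text \<open>
  The terms of the Leibniz sum assemble into a Meixner polynomial. The falling factorial of
  \<open>\<kappa> + m\<close> of order \<open>m - i\<close> is \<open>(\<kappa> + 1)\<^sub>m / (\<kappa> + 1)\<^sub>i\<close>. The powers with exponents \<open>- \<rho>\<close> and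
  \<open>n + \<rho> - i\<close> multiply to the integral power \<open>z\<^sup>n\<^sup>-\<^sup>i\<close>, so all dependence on the branch disappears, and
  \<open>cnj z\<^sup>m\<^sup>-\<^sup>i / z\<^sup>i = cnj z\<^sup>m / |z|\<^sup>2\<^sup>i\<close> gives the denominator of the argument \<open>(1 - |z|\<^sup>2) / |z|\<^sup>2\<close>.
\<close>
lemma frac_zernike_eq_meixner:
  assumes k: "\<kappa> > -1" and z: "z \<noteq> 0" "cmod z < 1"
  shows "frac_zernike \<kappa> \<rho> m n z
    = z powi n * cnj z ^ m * of_real (pochhammer (\<kappa> + 1) m)
      * meixner (of_real (- of_int n - \<rho>)) (of_real (\<kappa> + 1)) m
          (of_real ((1 - (cmod z)\<^sup>2) / (cmod z)\<^sup>2))"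
proof -
  define R where "R = 1 - (cmod z)\<^sup>2"
  have R: "R > 0" using z by (simp add: R_def abs_square_less_1)
  have zz: "complex_of_real ((cmod z)\<^sup>2) = z * cnj z"
    by (rule complex_norm_square)
  have "z \<in> slit_disc z" using z by (simp add: slit_disc_def)
  have ln: "local_ln z z = Ln z" using z by (simp add: local_ln_def)
  have pw: "local_powr z (- \<rho>) z * local_powr z (of_int n + \<rho> - of_nat i) z = z powi n / z ^ i" for i
  proof -
    have "local_powr z (- \<rho>) z * local_powr z (of_int n + \<rho> - of_nat i) z
        = exp (of_int n * Ln z - of_nat i * Ln z)"
      by (simp add: local_powr_def ln exp_add[symmetric] algebra_simps)
    also have "\<dots> = z powi n / z ^ i"
      using z by (simp add: exp_diff exp_of_nat_mult exp_power_int[symmetric])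
    finally show ?thesis .
  qed
  have "frac_zernike \<kappa> \<rho> m n z = (-1) ^ m * local_powr z (- \<rho>) z * of_real (R powr (- \<kappa>))
      * (wirtinger ^^ m) (disc_monom z (of_int n + \<rho>) 0 (\<kappa> + of_nat m)) z"
    by (simp add: frac_zernike_def R_def disc_monom_def[abs_def])
  also have "\<dots> = (\<Sum>i\<le>m. (-1) ^ m * local_powr z (- \<rho>) z * of_real (R powr (- \<kappa>))
      * (of_nat (m choose i) * ((-1) ^ i
         * of_real (pochhammer (- (of_int n + \<rho>)) i * pochhammer (- (\<kappa> + of_nat m)) (m - i))
         * disc_monom z (of_int n + \<rho> - of_nat i) (m - i) (\<kappa> + of_nat m - of_nat (m - i)) z)))"
    unfolding wirtinger_iter_disc_monom[OF \<open>z \<noteq> 0\<close> \<open>z \<in> slit_disc z\<close>] sum_distrib_left ..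
  also have "\<dots> = (\<Sum>i\<le>m. z powi n * cnj z ^ m * of_real (pochhammer (\<kappa> + 1) m)
      * (of_nat (m choose i) * pochhammer (of_real (- of_int n - \<rho>)) i
          / pochhammer (of_real (\<kappa> + 1)) i * of_real (R / (cmod z)\<^sup>2) ^ i))"
  proof (rule sum.cong)
    fix i assume "i \<in> {..m}"
    then have im: "i \<le> m" by simp
    have "\<kappa> + 1 > 0" using k by simp
    then have c: "pochhammer (\<kappa> + 1) i \<noteq> 0" using pochhammer_pos[of "\<kappa> + 1" i] by simp
    have "pochhammer (\<kappa> + 1) m = pochhammer (\<kappa> + 1) i * pochhammer (\<kappa> + 1 + of_nat i) (m - i)"
      using im by (rule pochhammer_product)
    moreover have "pochhammer (- (\<kappa> + of_nat m)) (m - i)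
        = (-1) ^ (m - i) * pochhammer (\<kappa> + 1 + of_nat i) (m - i)"
      unfolding pochhammer_minus using im by (simp add: of_nat_diff add_ac)
    ultimately have poch: "pochhammer (- (\<kappa> + of_nat m)) (m - i)
        = (-1) ^ (m - i) * (pochhammer (\<kappa> + 1) m / pochhammer (\<kappa> + 1) i)"
      using c by simp
    have sgn: "(-1) ^ m * ((-1) ^ i * (-1) ^ (m - i)) = (1 :: complex)"
      using im by (simp add: power_add[symmetric])
    have Rp: "R powr (- \<kappa>) * R powr (\<kappa> + of_nat m - of_nat (m - i)) = R ^ i"
      using im R by (simp add: powr_add[symmetric] of_nat_diff powr_realpow)
    have zp: "cnj z ^ (m - i) / z ^ i = cnj z ^ m / (z * cnj z) ^ i"
      using im z by (simp add: power_diff power_mult_distrib mult.commute)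
    have "(-1) ^ m * local_powr z (- \<rho>) z * of_real (R powr (- \<kappa>))
      * (of_nat (m choose i) * ((-1) ^ i
         * of_real (pochhammer (- (of_int n + \<rho>)) i * pochhammer (- (\<kappa> + of_nat m)) (m - i))
         * disc_monom z (of_int n + \<rho> - of_nat i) (m - i) (\<kappa> + of_nat m - of_nat (m - i)) z))
      = of_nat (m choose i) * of_real (pochhammer (- (of_int n + \<rho>)) i)
         * of_real (pochhammer (\<kappa> + 1) m / pochhammer (\<kappa> + 1) i)
         * ((-1) ^ m * ((-1) ^ i * (-1) ^ (m - i)))
         * (local_powr z (- \<rho>) z * local_powr z (of_int n + \<rho> - of_nat i) z)
         * cnj z ^ (m - i)
         * of_real (R powr (- \<kappa>) * R powr (\<kappa> + of_nat m - of_nat (m - i)))"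
      unfolding poch disc_monom_def R_def[symmetric] by (simp only: of_real_mult of_real_power of_real_minus of_real_1 mult_ac)
    also have "\<dots> = of_nat (m choose i) * of_real (pochhammer (- (of_int n + \<rho>)) i)
         * of_real (pochhammer (\<kappa> + 1) m / pochhammer (\<kappa> + 1) i)
         * z powi n * (cnj z ^ (m - i) / z ^ i) * of_real R ^ i"
      unfolding sgn pw Rp by simp
    also have "\<dots> = z powi n * cnj z ^ m * of_real (pochhammer (\<kappa> + 1) m)
      * (of_nat (m choose i) * pochhammer (of_real (- of_int n - \<rho>)) i
          / pochhammer (of_real (\<kappa> + 1)) i * of_real (R / (cmod z)\<^sup>2) ^ i)"
      unfolding zp pochhammer_of_real of_real_divide zz
      by (simp add: power_divide)
    finally show "(-1) ^ m * local_powr z (- \<rho>) z * of_real (R powr (- \<kappa>))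
      * (of_nat (m choose i) * ((-1) ^ i
         * of_real (pochhammer (- (of_int n + \<rho>)) i * pochhammer (- (\<kappa> + of_nat m)) (m - i))
         * disc_monom z (of_int n + \<rho> - of_nat i) (m - i) (\<kappa> + of_nat m - of_nat (m - i)) z))
      = z powi n * cnj z ^ m * of_real (pochhammer (\<kappa> + 1) m)
      * (of_nat (m choose i) * pochhammer (of_real (- of_int n - \<rho>)) i
          / pochhammer (of_real (\<kappa> + 1)) i * of_real (R / (cmod z)\<^sup>2) ^ i)" .
  qed simp
  finally show ?thesis
    by (simp add: meixner_def sum_distrib_left R_def)
qed

section \<open>Convergence and the closed form\<close>

text \<open>
  The quotient of consecutive coefficients is bounded, so the coefficients grow at most geometrically.
  A bound is preferable to the limit of the quotient here, because the series
  terminates when \<open>- b\<close> is a natural number.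
\<close>
lemma fps_hypergeo_conv_radius_pos:
  fixes b c :: complex
  assumes c: "Re c > 0"
  shows "fps_conv_radius (fps_hypergeo [b, b] [c] 1) > 0"
proof -
  define h where "h k = fps_hypergeo [b, b] [c] 1 $ k" for k
  define M where "M = (1 + cmod b) * (1 + cmod b / Re c)"
  have M: "M > 0" using c by (auto simp: M_def add_pos_nonneg)
  have step: "cmod (h (Suc k)) \<le> M * cmod (h k)" for k
  proof -
    have "h (Suc k) = (b + of_nat k) / of_nat (Suc k) * ((b + of_nat k) / (c + of_nat k)) * h k"
      unfolding h_def by (subst fps_hypergeo_rec) (simp del: fps_hypergeo_nth of_nat_Suc)
    moreover have "cmod ((b + of_nat k) / of_nat (Suc k)) \<le> 1 + cmod b"
    proof -
      have "cmod (b + of_nat k) \<le> cmod b + real k"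
        using norm_triangle_ineq[of b "of_nat k"] by simp
      also have "\<dots> \<le> (1 + cmod b) * real (Suc k)"
        by (simp add: algebra_simps)
      finally show ?thesis
        by (simp add: norm_divide divide_le_eq del: of_nat_Suc)
    qed
    moreover have "cmod ((b + of_nat k) / (c + of_nat k)) \<le> 1 + cmod b / Re c"
    proof -
      have "cmod (b + of_nat k) \<le> cmod b + real k"
        using norm_triangle_ineq[of b "of_nat k"] by simp
      also have "\<dots> \<le> (1 + cmod b / Re c) * (Re c + real k)"
        using c by (simp add: field_simps)
      also have "Re c + real k \<le> cmod (c + of_nat k)"
        using complex_Re_le_cmod[of "c + of_nat k"] by simp
      then have "(1 + cmod b / Re c) * (Re c + real k) \<le> (1 + cmod b / Re c) * cmod (c + of_nat k)"
        using c by (intro mult_left_mono) auto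
      finally have "cmod (b + of_nat k) \<le> (1 + cmod b / Re c) * cmod (c + of_nat k)" .
      moreover have "cmod (c + of_nat k) > 0"
        by (rule less_le_trans[OF _ complex_Re_le_cmod]) (use c in simp)
      ultimately show ?thesis
        by (simp add: norm_divide divide_le_eq)
    qed
    ultimately show ?thesis
      using c unfolding M_def by (simp only: norm_mult) (intro mult_right_mono mult_mono, auto)
  qed
  have bound: "cmod (h k) \<le> M ^ k" for k
  proof (induction k)
    case 0
    then show ?case by (simp add: h_def)
  next
    case (Suc k)
    then have "M * cmod (h k) \<le> M * M ^ k"
      using M by (intro mult_left_mono) auto
    then show ?case using step[of k] by simp
  qed
  define r where "r = 1 / (2 * M)"
  have r: "r > 0" using M by (simp add: r_def)
  have "summable (\<lambda>k. h k * of_real r ^ k)"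
  proof (rule summable_comparison_test')
    show "summable (\<lambda>k. (1 / 2 :: real) ^ k)" by (rule summable_geometric) simp
  next
    fix k :: nat
    have "norm (h k * of_real r ^ k) \<le> M ^ k * r ^ k"
      using bound[of k] r by (auto simp: norm_mult norm_power intro!: mult_right_mono)
    also have "\<dots> = (1 / 2) ^ k"
      using M by (simp add: r_def power_mult_distrib[symmetric])
    finally show "norm (h k * of_real r ^ k) \<le> (1 / 2) ^ k" .
  qed
  then have "conv_radius h \<ge> norm (complex_of_real r)"
    by (rule conv_radius_geI)
  then show ?thesis
    using r by (simp add: fps_conv_radius_def h_def[abs_def] less_le_trans[of 0 "ereal r"] del: fps_hypergeo_nth)
qed

lemma has_fps_expansion_geom_pow:
  "(\<lambda>s. (1 - x * s) powr (- b)) has_fps_expansion geom_pow b x" for b x :: complex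
proof -
  have lin: "(\<lambda>s. (- x) * s) has_fps_expansion fps_const (- x) * fps_X"
    by (intro fps_expansion_intros)
  have "((\<lambda>s. (1 + s) powr (- b)) \<circ> (\<lambda>s. (- x) * s)) has_fps_expansion
          (fps_binomial (- b) oo fps_const (- x) * fps_X)"
    by (intro has_fps_expansion_compose has_fps_expansion_binomial_complex lin) simp
  moreover have "(fps_binomial (- b) oo fps_const (- x) * fps_X) = geom_pow b x"
    unfolding fps_compose_linear
  proof (rule fps_ext)
    fix n
    have "(- b gchoose n) * (- x) ^ n = pochhammer b n / fact n * (((- 1) ^ n * (- 1) ^ n) * x ^ n)"
      unfolding gbinomial_pochhammer power_minus[of x] by simp
    also have "(- 1) ^ n * (- 1) ^ n = (1 :: complex)"
      by (simp flip: power_mult_distrib)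
    finally show "Abs_fps (\<lambda>n. (- x) ^ n * fps_binomial (- b) $ n) $ n = geom_pow b x $ n"
      by (simp add: mult.commute)
  qed
  ultimately show ?thesis by (simp add: o_def)
qed

text \<open>
  The closed form is analytic at \<open>s = 0\<close>, and its power series there was computed formally. Hence
  that series has a positive radius of convergence and represents the closed form near \<open>0\<close>; no
  rearrangement of multiple series is required.
\<close>
lemma meixner_bilinear_sums:
  fixes b c x y :: complex
  assumes c: "Re c > 0"
  shows "\<exists>\<delta>>0. \<forall>s. norm s < \<delta> \<longrightarrow>
    (\<lambda>m. pochhammer c m / fact m * meixner b c m x * meixner b c m y * s ^ m) sums
      ((1 - (1 + x) * s) powr (- b) * (1 - (1 + y) * s) powr (- b) * (1 - s) powr (- (c - 2 * b))
        * gauss_2F1 b b c (x * y * s / ((1 - (1 + x) * s) * (1 - (1 + y) * s))))"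
proof -
  define A where "A = geom_pow b (1 + x) * geom_pow b (1 + y) * geom_pow (c - 2 * b) 1"
  define G where "G = fps_const (x * y) * fps_X * geom_pow 1 (1 + x) * geom_pow 1 (1 + y)"
  define H where "H = fps_hypergeo [b, b] [c] 1"
  define f where "f s = (1 - (1 + x) * s) powr (- b) * (1 - (1 + y) * s) powr (- b)
      * (1 - 1 * s) powr (- (c - 2 * b))
        * (eval_fps H \<circ> (\<lambda>s. x * y * s * (1 - (1 + x) * s) powr (- 1) * (1 - (1 + y) * s) powr (- 1))) s" for s
  have "pochhammer c k \<noteq> 0" for k
    using c by (auto simp: pochhammer_eq_0_iff)
  then have nth: "(A * (H oo G)) $ m = pochhammer c m / fact m * meixner b c m x * meixner b c m y" for m
    unfolding A_def G_def H_def by (rule meixner_bilinear_nth)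
  have "eval_fps H has_fps_expansion H"
    unfolding H_def by (intro eval_fps_has_fps_expansion fps_hypergeo_conv_radius_pos c)
  moreover have "(\<lambda>s. x * y * s * (1 - (1 + x) * s) powr (- 1) * (1 - (1 + y) * s) powr (- 1)) has_fps_expansion G"
    unfolding G_def by (intro has_fps_expansion_mult has_fps_expansion_cmult_left
        has_fps_expansion_fps_X has_fps_expansion_geom_pow)
  ultimately have "f has_fps_expansion A * (H oo G)"
    unfolding f_def A_def
    by (intro has_fps_expansion_mult has_fps_expansion_compose has_fps_expansion_geom_pow)
       (simp_all add: G_def)
  then have rad: "fps_conv_radius (A * (H oo G)) > 0"
    and "eventually (\<lambda>s. eval_fps (A * (H oo G)) s = f s) (nhds 0)"
    by (auto simp: has_fps_expansion_def)
  then obtain d where d: "d > 0" "\<And>s. norm s < d \<Longrightarrow> eval_fps (A * (H oo G)) s = f s"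
    by (auto simp: eventually_nhds_metric)
  obtain r where r: "r > 0" "ereal r < fps_conv_radius (A * (H oo G))"
    using rad by (metis ereal_dense2 ereal_less(2))
  have "(\<lambda>m. pochhammer c m / fact m * meixner b c m x * meixner b c m y * s ^ m) sums
      ((1 - (1 + x) * s) powr (- b) * (1 - (1 + y) * s) powr (- b) * (1 - s) powr (- (c - 2 * b))
        * gauss_2F1 b b c (x * y * s / ((1 - (1 + x) * s) * (1 - (1 + y) * s))))"
    if s: "norm s < min d r" for s
  proof -
    have "ereal (norm s) < fps_conv_radius (A * (H oo G))"
      using s r by (meson ereal_less_eq(3) le_less_trans less_imp_le min_less_iff_conj)
    from sums_eval_fps[OF this]
    have "(\<lambda>m. (A * (H oo G)) $ m * s ^ m) sums f s"
      using d s by simp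
    moreover have inv: "v powr (- 1) = inverse v" for v :: complex
      by (simp add: powr_minus)
    have "f s = (1 - (1 + x) * s) powr (- b) * (1 - (1 + y) * s) powr (- b) * (1 - s) powr (- (c - 2 * b))
        * gauss_2F1 b b c (x * y * s / ((1 - (1 + x) * s) * (1 - (1 + y) * s)))"
      unfolding f_def gauss_2F1_def H_def[symmetric] o_def inv by (simp add: divide_inverse mult.assoc)
    ultimately show ?thesis unfolding nth by simp
  qed
  then show ?thesis
    using d(1) r(1) by (intro exI[of _ "min d r"]) simp
qed

theorem proposition3p20:
  fixes \<rho> \<kappa> :: real and n :: int and z w :: complex
  assumes "\<rho> > -1" and "\<kappa> > -1" and "of_int n + \<rho> \<ge> 0"
    and "z \<in> ball 0 1 - {0}" and "w \<in> ball 0 1 - {0}"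
  shows "\<exists>\<delta>>0. \<forall>t::complex. norm t < \<delta> \<longrightarrow>
           summable (zernike_term \<kappa> \<rho> n z w t) \<and>
           zernike_gen \<kappa> \<rho> n z w t = zernike_closed \<kappa> \<rho> n z w (- t)"
proof -
  have z: "z \<noteq> 0" "cmod z < 1" and w: "w \<noteq> 0" "cmod w < 1"
    using assms by auto
  define b where "b = complex_of_real (- of_int n - \<rho>)"
  define c where "c = complex_of_real (\<kappa> + 1)"
  define x where "x = complex_of_real ((1 - (cmod z)\<^sup>2) / (cmod z)\<^sup>2)"
  define y where "y = complex_of_real ((1 - (cmod w)\<^sup>2) / (cmod w)\<^sup>2)"
  define \<Phi> where "\<Phi> s = (1 - (1 + x) * s) powr (- b) * (1 - (1 + y) * s) powr (- b) * (1 - s) powr (- (c - 2 * b))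
        * gauss_2F1 b b c (x * y * s / ((1 - (1 + x) * s) * (1 - (1 + y) * s)))" for s
  have c: "Re c > 0" using assms by (simp add: c_def)
  obtain \<delta> where \<delta>: "\<delta> > 0" "\<And>s. norm s < \<delta> \<Longrightarrow>
      (\<lambda>m. pochhammer c m / fact m * meixner b c m x * meixner b c m y * s ^ m) sums \<Phi> s"
    using meixner_bilinear_sums[OF c, of b x y] unfolding \<Phi>_def by blast
  have zz: "complex_of_real ((cmod z)\<^sup>2) = z * cnj z" and ww: "complex_of_real ((cmod w)\<^sup>2) = w * cnj w"
    by (rule complex_norm_square)+
  have c0: "pochhammer c m \<noteq> 0" for m
    using c by (auto simp: pochhammer_eq_0_iff)
  have "zernike_term \<kappa> \<rho> n z w t sums zernike_closed \<kappa> \<rho> n z w (- t)" if t: "norm t < \<delta>" for t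
  proof -
    define s where "s = t * cnj z * w"
    have "norm s = norm t * (cmod z * cmod w)"
      by (simp add: s_def norm_mult)
    also have "\<dots> \<le> norm t * (1 * 1)"
      using z w by (intro mult_left_mono mult_mono) auto
    finally have "norm s < \<delta>" using t by simp
    \<comment> \<open>Up to the factor \<open>(z * cnj w) powi n\<close> both sides depend on \<open>t\<close> only through \<open>s\<close>.\<close>
    from sums_mult[OF \<delta>(2)[OF this], of "(z * cnj w) powi n"]
    have "(\<lambda>m. (z * cnj w) powi n * (pochhammer c m / fact m * meixner b c m x * meixner b c m y * s ^ m))
        sums ((z * cnj w) powi n * \<Phi> s)" .
    moreover have term_eq: "zernike_term \<kappa> \<rho> n z w t m
        = (z * cnj w) powi n * (pochhammer c m / fact m * meixner b c m x * meixner b c m y * s ^ m)" for m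
    proof -
      have Zz: "frac_zernike \<kappa> \<rho> m n z = z powi n * cnj z ^ m * pochhammer c m * meixner b c m x"
        unfolding b_def c_def x_def pochhammer_of_real
        by (rule frac_zernike_eq_meixner[OF assms(2) z])
      have Zw: "frac_zernike \<kappa> \<rho> m n (cnj w) = cnj w powi n * w ^ m * pochhammer c m * meixner b c m y"
        unfolding b_def c_def y_def pochhammer_of_real
        using frac_zernike_eq_meixner[OF assms(2), of "cnj w" \<rho> m n] w by simp
      have cancel: "T * (P * Z * C * M) * (Q * W * C * N) / (F * C) = P * Q * (C / F * M * N * (T * Z * W))"
        if "C \<noteq> 0" for T P Z C M Q W N F :: complex
        using that by simp
      show ?thesis
        unfolding zernike_term_def Zz Zw pochhammer_of_real[symmetric] c_def[symmetric] s_def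
          power_int_mult_distrib power_mult_distrib
        using c0 by (rule cancel)
    qed
    moreover have "(z * cnj w) powi n * \<Phi> s = zernike_closed \<kappa> \<rho> n z w (- t)"
    proof -
      \<comment> \<open>The substitution \<open>1 + x = 1 / |z|\<^sup>2\<close> makes the linear factors in \<open>s\<close> those of the closed form at \<open>- t\<close>.\<close>
      have x1: "1 + x = 1 / (z * cnj z)" and y1: "1 + y = 1 / (w * cnj w)"
        using z w unfolding x_def y_def of_real_divide of_real_diff zz ww by (simp_all add: field_simps)
      have e1: "1 - (1 + x) * s = 1 + (- t) * w / z" and e2: "1 - (1 + y) * s = 1 + (- t) * cnj z / cnj w"
        using z w unfolding x1 y1 s_def by (simp_all add: field_simps)
      have e3: "1 - s = 1 + (- t) * cnj z * w"
        by (simp add: s_def)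
      have arg: "x * y * s / ((1 - (1 + x) * s) * (1 - (1 + y) * s))
          = - ((- t) * of_real (1 - (cmod z)\<^sup>2) * of_real (1 - (cmod w)\<^sup>2)
             / ((z + (- t) * w) * (cnj w + (- t) * cnj z)))"
      proof -
        have f1: "z + (- t) * w = z * (1 + (- t) * w / z)" and f2: "cnj w + (- t) * cnj z = cnj w * (1 + (- t) * cnj z / cnj w)"
          using z w by (simp_all add: field_simps)
        have quot: "p / (z * z') * (q / (w * w')) * (t * z' * w) = t * p * q / (z * w')"
          if "z' \<noteq> 0" "w \<noteq> 0" for p q z z' w w' :: complex
          using that by simp
        have xy: "x * y * s = t * of_real (1 - (cmod z)\<^sup>2) * of_real (1 - (cmod w)\<^sup>2) / (z * cnj w)"
          unfolding x_def y_def s_def of_real_divide zz ww by (rule quot) (use z w in auto)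
        show ?thesis
          unfolding e1 e2 xy f1 f2 by (simp add: mult_ac)
      qed
      have expo: "of_real (of_int n + \<rho>) = - b" "of_real (2 * (of_int n + \<rho>) + \<kappa> + 1) = c - 2 * b"
        by (simp_all add: b_def c_def)
      show ?thesis
        unfolding \<Phi>_def arg
        unfolding zernike_closed_def b_def[symmetric] c_def[symmetric] expo e1 e2 e3
          powr_minus[of _ "c - 2 * b"] divide_inverse
        by (simp only: mult.assoc)
    qed
    ultimately show ?thesis unfolding term_eq[abs_def] by (simp only:)
  qed
  then have "\<forall>t. norm t < \<delta> \<longrightarrow> summable (zernike_term \<kappa> \<rho> n z w t) \<and>
           zernike_gen \<kappa> \<rho> n z w t = zernike_closed \<kappa> \<rho> n z w (- t)"
    by (auto simp: zernike_gen_def sums_iff)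
  then show ?thesis using \<delta>(1) by blast
qed

end
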